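(* Let $v,d\ge1$ be integers and let $m=(m_1,\dots,m_d)^T$ be a vector of positive integers. Suppose that there is an exact design $\xi\in D(v,d,m)$ that satisfies $\xi(0,k)=m_k/2$ for $1\le k\le d$ and is equireplicated in the test treatments, i.e. $r_1(\xi)=\cdots=r_v(\xi)$. Then $\xi$ is $E$-optimal for comparisons with a control in $D(v,d,m)$. Moreover, $\xi$ is optimal for $\left(\sum_{i=1}^v\tau_i\right)/v-\tau_0$ in $D(v,d,m)$ (it minimizes the variance of the least squares estimator of this contrast), and it minimizes $$\sum_{i=1}^v\mathrm{Var}(\widehat{\tau_i-\tau_0})+\sum_{1\le i\ne j\le v}\left|\mathrm{Cov}(\widehat{\tau_i-\tau_0},\widehat{\tau_j-\tau_0})\right|$$ over the feasible designs in $D(v,d,m)$.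
   Context: Treatments are labelled $0,1,\dots,v$ ($0$ is the control, the others are test treatments); blocks are labelled $1,\dots,d$. The model is $Y_j=\mu+\tau_{i(j)}+\theta_{k(j)}+\varepsilon_j$, $j=1,\dots,n$, with treatment effects $\tau=(\tau_0,\dots,\tau_v)^T$, block effects $\theta_1,\dots,\theta_d$, and uncorrelated zero-mean errors of common variance $\sigma^2<\infty$. $D(v,d,m)$ is the class of exact block designs with block sizes $m_1,\dots,m_d$: functions $\xi:\{0,\dots,v\}\times\{1,\dots,d\}\to\{0,1,2,\dots\}$ with $\sum_{i=0}^v\xi(i,k)=m_k$ for every $k$; here $\xi(i,k)$ is the number of trials with treatment $i$ in block $k$, and $n=\sum_km_k$. Put $r_i(\xi)=\sum_k\xi(i,k)$, $r=(r_0,\dots,r_v)^T$, $s=m$, $s^{-1}=(m_1^{-1},\dots,m_d^{-1})$, $X(\xi)=(\xi(i,k))_{0\le i\le v,\,1\le k\le d}$, $Z(\xi)=(\xi(i,k))_{1\le i\le v,\,1\le k\le d}$. Let $M(\xi)=\mathrm{diag}(r)-X\,\mathrm{diag}(s^{-1})X^T$ and $Q=(-1_v,I_v)^T$ ($1_v$ the all-ones vector), so $Q^T\tau=(\tau_1-\tau_0,\dots,\tau_v-\tau_0)^T$. The design is feasible if the column space of $Q$ is contained in that of $M(\xi)$. For feasible $\xi$ the information matrix for treatment-control comparisons is $$N(\xi)=\mathrm{diag}(r_1,\dots,r_v)-Z\,\mathrm{diag}(s^{-1})Z^T=(Q^TM^-(\xi)Q)^{-1},$$ and the covariance matrix of the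 least squares estimators $\widehat{\tau_1-\tau_0},\dots,\widehat{\tau_v-\tau_0}$ is $\sigma^2N^{-1}(\xi)$. A feasible design is $E$-optimal in $D(v,d,m)$ if it minimizes the largest eigenvalue of $N^{-1}(\xi)$ over all feasible designs in $D(v,d,m)$. The variance of the least squares estimator of $(\sum_{i=1}^v\tau_i)/v-\tau_0$ is $\sigma^2\,1_v^TN^{-1}(\xi)1_v/v^2$. *)

theory Defs
  imports "HOL-Probability.Probability"
begin

text \<open>
  The treatments are the elements of \<open>'v option\<close>: \<open>None\<close> is the control and
  \<open>Some i\<close> are the test treatments, so \<open>v = CARD('v)\<close>. The blocks are the elements of
  \<open>'d\<close>, so \<open>d = CARD('d)\<close>.
\<close>

type_synonym ('v, 'd) design = "'v option \<Rightarrow> 'd \<Rightarrow> nat"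

definition designs :: "('d::finite \<Rightarrow> nat) \<Rightarrow> ('v::finite, 'd) design set" where
  "designs m = {\<xi>. \<forall>k. (\<Sum>i\<in>UNIV. \<xi> i k) = m k}"

definition num_trials :: "('d::finite \<Rightarrow> nat) \<Rightarrow> nat" where
  "num_trials m = (\<Sum>k\<in>UNIV. m k)"

definition replication :: "('v::finite, 'd::finite) design \<Rightarrow> 'v option \<Rightarrow> nat" where
  "replication \<xi> i = (\<Sum>k\<in>UNIV. \<xi> i k)"

definition diag_matrix :: "('n::finite \<Rightarrow> real) \<Rightarrow> real ^ 'n ^ 'n" where
  "diag_matrix f = (\<chi> i j. if i = j then f i else 0)"

definition incidence :: "('v::finite, 'd::finite) design \<Rightarrow> real ^ 'd ^ ('v option)" where
  "incidence \<xi> = (\<chi> i k. real (\<xi> i k))"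

definition test_incidence :: "('v::finite, 'd::finite) design \<Rightarrow> real ^ 'd ^ 'v" where
  "test_incidence \<xi> = (\<chi> i k. real (\<xi> (Some i) k))"

definition treatment_info ::
  "('d::finite \<Rightarrow> nat) \<Rightarrow> ('v::finite, 'd) design \<Rightarrow> real ^ ('v option) ^ ('v option)" where
  "treatment_info m \<xi> =
     diag_matrix (\<lambda>i. real (replication \<xi> i))
     - incidence \<xi> ** diag_matrix (\<lambda>k. 1 / real (m k)) ** transpose (incidence \<xi>)"

definition control_info ::
  "('d::finite \<Rightarrow> nat) \<Rightarrow> ('v::finite, 'd) design \<Rightarrow> real ^ 'v ^ 'v" where
  "control_info m \<xi> =
     diag_matrix (\<lambda>i. real (replication \<xi> (Some i)))
     - test_incidence \<xi> ** diag_matrix (\<lambda>k. 1 / real (m k)) ** transpose (test_incidence \<xi>)"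

definition control_contrasts :: "real ^ 'v::finite ^ ('v option)" where
  "control_contrasts =
     (\<chi> i j. case i of None \<Rightarrow> - 1 | Some i' \<Rightarrow> if i' = j then 1 else 0)"

definition average_contrast :: "real ^ ('v::finite option)" where
  "average_contrast =
     (\<chi> i. case i of None \<Rightarrow> - 1 | Some _ \<Rightarrow> 1 / real CARD('v))"

definition estimable ::
  "('d::finite \<Rightarrow> nat) \<Rightarrow> real ^ ('v::finite option) \<Rightarrow> ('v, 'd) design \<Rightarrow> bool" where
  "estimable m c \<xi> \<longleftrightarrow> c \<in> span (columns (treatment_info m \<xi>))"

definition feasible :: "('d::finite \<Rightarrow> nat) \<Rightarrow> ('v::finite, 'd) design \<Rightarrow> bool" where
  "feasible m \<xi> \<longleftrightarrow>
     span (columns (control_contrasts :: real ^ 'v ^ ('v option)))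
     \<subseteq> span (columns (treatment_info m \<xi>))"

definition eigenvalue :: "real ^ 'n::finite ^ 'n \<Rightarrow> real \<Rightarrow> bool" where
  "eigenvalue A l \<longleftrightarrow> (\<exists>x. x \<noteq> 0 \<and> A *v x = l *s x)"

definition max_eigenvalue :: "real ^ 'n::finite ^ 'n \<Rightarrow> real" where
  "max_eigenvalue A = Max {l. eigenvalue A l}"

definition E_optimal :: "('d::finite \<Rightarrow> nat) \<Rightarrow> ('v::finite, 'd) design \<Rightarrow> bool" where
  "E_optimal m \<xi> \<longleftrightarrow>
     is_arg_min (\<lambda>\<zeta>. max_eigenvalue (matrix_inv (control_info m \<zeta>)))
       (\<lambda>\<zeta>. \<zeta> \<in> designs m \<and> feasible m \<zeta>) \<xi>"

text \<open>
  A layout lists, for each trial \<open>j \<in> {1..n}\<close>, the pair (treatment \<open>i(j)\<close>, block \<open>k(j)\<close>).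
  A design determines its layout only up to the order of the trials.
\<close>

definition layouts ::
  "('d::finite \<Rightarrow> nat) \<Rightarrow> ('v::finite, 'd) design \<Rightarrow> (nat \<Rightarrow> 'v option \<times> 'd) set" where
  "layouts m \<xi> = {L. \<forall>i k. card {j \<in> {1..num_trials m}. L j = (i, k)} = \<xi> i k}"

type_synonym ('v, 'd) params = "real \<times> (real ^ ('v option)) \<times> (real ^ 'd)"

fun mean_response ::
  "(nat \<Rightarrow> 'v::finite option \<times> 'd::finite) \<Rightarrow> ('v, 'd) params \<Rightarrow> nat \<Rightarrow> real" where
  "mean_response L (\<mu>, \<tau>, \<theta>) j = \<mu> + \<tau> $ fst (L j) + \<theta> $ snd (L j)"

definition response ::
  "(nat \<Rightarrow> 'v::finite option \<times> 'd::finite) \<Rightarrow> ('v, 'd) params \<Rightarrow> (nat \<Rightarrow> 'a \<Rightarrow> real)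
    \<Rightarrow> 'a \<Rightarrow> nat \<Rightarrow> real" where
  "response L \<beta> \<epsilon> \<omega> j = mean_response L \<beta> j + \<epsilon> j \<omega>"

definition uncorrelated_errors :: "'a measure \<Rightarrow> nat \<Rightarrow> real \<Rightarrow> (nat \<Rightarrow> 'a \<Rightarrow> real) \<Rightarrow> bool" where
  "uncorrelated_errors P n \<sigma> \<epsilon> \<longleftrightarrow>
     prob_space P
     \<and> (\<forall>j\<in>{1..n}. \<epsilon> j \<in> borel_measurable P \<and> integrable P (\<lambda>\<omega>. (\<epsilon> j \<omega>)\<^sup>2)
          \<and> prob_space.expectation P (\<epsilon> j) = 0 \<and> prob_space.variance P (\<epsilon> j) = \<sigma>\<^sup>2)
     \<and> (\<forall>i\<in>{1..n}. \<forall>j\<in>{1..n}. i \<noteq> j \<longrightarrow> prob_space.expectation P (\<lambda>\<omega>. \<epsilon> i \<omega> * \<epsilon> j \<omega>) = 0)"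

definition residual_ss ::
  "nat \<Rightarrow> (nat \<Rightarrow> 'v::finite option \<times> 'd::finite) \<Rightarrow> (nat \<Rightarrow> real) \<Rightarrow> ('v, 'd) params \<Rightarrow> real" where
  "residual_ss n L y \<beta> = (\<Sum>j=1..n. (y j - mean_response L \<beta> j)\<^sup>2)"

text \<open>
  The least squares solution is not unique, because \<open>\<mu>\<close>, \<open>\<tau>\<close> and \<open>\<theta>\<close> are not
  identifiable; the value \<open>c \<bullet> \<tau>\<close> is the same for all solutions as soon as \<open>c\<close> is
  estimable, so the choice made by \<^const>\<open>arg_min\<close> is then immaterial.
\<close>

definition lse ::
  "nat \<Rightarrow> (nat \<Rightarrow> 'v::finite option \<times> 'd::finite) \<Rightarrow> real ^ ('v option) \<Rightarrow> (nat \<Rightarrow> real) \<Rightarrow> real"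
  where
  "lse n L c y = c \<bullet> fst (snd (arg_min (residual_ss n L y) (\<lambda>_. True)))"

definition covariance :: "'a measure \<Rightarrow> ('a \<Rightarrow> real) \<Rightarrow> ('a \<Rightarrow> real) \<Rightarrow> real" where
  "covariance P X Y =
     prob_space.expectation P
       (\<lambda>\<omega>. (X \<omega> - prob_space.expectation P X) * (Y \<omega> - prob_space.expectation P Y))"

definition lse_cov ::
  "'a measure \<Rightarrow> (nat \<Rightarrow> 'a \<Rightarrow> real) \<Rightarrow> ('v::finite, 'd::finite) params \<Rightarrow> nat
    \<Rightarrow> (nat \<Rightarrow> 'v option \<times> 'd) \<Rightarrow> real ^ ('v option) \<Rightarrow> real ^ ('v option) \<Rightarrow> real" where
  "lse_cov P \<epsilon> \<beta> n L c c' =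
     covariance P (\<lambda>\<omega>. lse n L c (response L \<beta> \<epsilon> \<omega>)) (\<lambda>\<omega>. lse n L c' (response L \<beta> \<epsilon> \<omega>))"

definition lse_var ::
  "'a measure \<Rightarrow> (nat \<Rightarrow> 'a \<Rightarrow> real) \<Rightarrow> ('v::finite, 'd::finite) params \<Rightarrow> nat
    \<Rightarrow> (nat \<Rightarrow> 'v option \<times> 'd) \<Rightarrow> real ^ ('v option) \<Rightarrow> real" where
  "lse_var P \<epsilon> \<beta> n L c = prob_space.variance P (\<lambda>\<omega>. lse n L c (response L \<beta> \<epsilon> \<omega>))"

definition abs_cov_sum ::
  "'a measure \<Rightarrow> (nat \<Rightarrow> 'a \<Rightarrow> real) \<Rightarrow> ('v::finite, 'd::finite) params \<Rightarrow> nat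
    \<Rightarrow> (nat \<Rightarrow> 'v option \<times> 'd) \<Rightarrow> real" where
  "abs_cov_sum P \<epsilon> \<beta> n L =
     (\<Sum>i\<in>UNIV. lse_var P \<epsilon> \<beta> n L (column i control_contrasts))
     + (\<Sum>(i, j)\<in>{(i, j). i \<noteq> j}.
          \<bar>lse_cov P \<epsilon> \<beta> n L (column i control_contrasts) (column j control_contrasts)\<bar>)"

text \<open>
  A criterion evaluated on layouts is minimized by a design if each layout of the design does
  at least as well as each layout of any competing design.
\<close>

definition minimizes ::
  "('d::finite \<Rightarrow> nat) \<Rightarrow> (('v::finite, 'd) design \<Rightarrow> bool)
    \<Rightarrow> ((nat \<Rightarrow> 'v option \<times> 'd) \<Rightarrow> real) \<Rightarrow> ('v, 'd) design \<Rightarrow> bool" where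
  "minimizes m adm crit \<xi> \<longleftrightarrow>
     \<xi> \<in> designs m \<and> adm \<xi>
     \<and> (\<forall>L \<in> layouts m \<xi>. \<forall>\<zeta> \<in> designs m. adm \<zeta> \<longrightarrow> (\<forall>K \<in> layouts m \<zeta>. crit L \<le> crit K))"

end

theory Submission
  imports Defs
begin

text \<open>
  Write \<open>n\<close> for the number of trials, \<open>M\<close> and \<open>N\<close> for the treatment and control information
  matrices, and \<open>c\<close> for the average contrast. All three optimality claims come from one lower bound:
  no design estimates \<open>c \<bullet> \<tau>\<close> with variance below \<open>4 \<sigma>\<^sup>2 / n\<close>.

  The bound is a test of the form \<open>M\<close> against the unit vector \<open>e\<close> of the control. If \<open>M x = c\<close>, then
  the variance is \<open>\<sigma>\<^sup>2 (x \<bullet> c)\<close> and \<open>e \<bullet> M x = - 1\<close>, so that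
  \<open>0 \<le> (x + t e) \<bullet> M (x + t e) = x \<bullet> c - 2 t + t\<^sup>2 (e \<bullet> M e)\<close> for every \<open>t\<close>. Each block of size
  \<open>s\<close> with \<open>a\<close> control trials contributes \<open>a (s - a) / s \<le> s / 4\<close> to \<open>e \<bullet> M e\<close>, hence
  \<open>e \<bullet> M e \<le> n / 4\<close>, and \<open>t = 4 / n\<close> gives \<open>x \<bullet> c \<ge> 4 / n\<close>
  (\<open>average_contrast_variance_bound\<close>). When half of every block is control and the test treatments
  are equireplicated, \<open>M e = - (n / 4) c\<close>, so that \<open>x = - (4 / n) e\<close> attains the bound
  (\<open>average_contrast_solution\<close>).

  In terms of \<open>N\<close>, the bound says that the entries of the inverse of \<open>N\<close> add up to at least
  \<open>4 v\<^sup>2 / n\<close> (\<open>inverse_control_info_sum_bound\<close>). Divided by \<open>v\<close> this sum is the Rayleigh quotient of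
  the all-ones vector, so the largest eigenvalue of the inverse is at least \<open>4 v / n\<close>; multiplied by
  \<open>\<sigma>\<^sup>2\<close> it is the sum of all covariances, which is at most the sum of their absolute values.
  Both of these consequences are sharp for the half-control design: its matrix \<open>N\<close> has nonpositive
  off-diagonal entries and all row sums equal to \<open>n / (4 v)\<close>, so its inverse has nonnegative entries and all
  row sums equal to \<open>4 v / n\<close>. No absolute value then changes a covariance, and an eigenvalue
  of a nonnegative matrix cannot exceed the common row sum.

  The link to statistics is that the least squares estimator of \<open>c \<bullet> \<tau>\<close> is a weighted sum of the
  responses, the weight of a trial being the deviation of \<open>x\<close> at its treatment from the mean of \<open>x\<close>
  over its block (\<open>lse_eq_weighted_sum\<close>). These weights are themselves the mean responses of some
  parameter vector, so the normal equations let the fitted values be replaced by the responses.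
\<close>

section \<open>Symmetric matrices\<close>

lemma symmetric_inner:
  fixes A :: "real ^ 'n ^ 'n"
  assumes "transpose A = A"
  shows "x \<bullet> (A *v y) = (A *v x) \<bullet> y"
  by (metis assms dot_lmul_matrix transpose_matrix_vector)

lemma form_add_scaled:
  fixes A :: "real ^ 'n ^ 'n"
  assumes "transpose A = A"
  shows "(x + t *\<^sub>R y) \<bullet> (A *v (x + t *\<^sub>R y))
    = x \<bullet> (A *v x) + 2 * t * (y \<bullet> (A *v x)) + t\<^sup>2 * (y \<bullet> (A *v y))"
proof -
  have "x \<bullet> (A *v y) = y \<bullet> (A *v x)"
    using symmetric_inner[OF assms, of x y] by (simp add: inner_commute)
  then show ?thesis
    by (simp add: matrix_vector_right_distrib matrix_vector_mult_scaleR inner_add_left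
        inner_add_right power2_eq_square algebra_simps)
qed

lemma quadratic_nonneg_imp_linear_zero:
  fixes a b :: real
  assumes "\<And>t. 0 \<le> 2 * t * a + t\<^sup>2 * b"
  shows "a = 0"
proof -
  \<comment> \<open>At this \<open>t\<close> the linear term is negative and outweighs the quadratic one, unless \<open>a = 0\<close>.\<close>
  have "0 \<le> 2 * (- a / (\<bar>b\<bar> + 1)) * a + (- a / (\<bar>b\<bar> + 1))\<^sup>2 * b" by (rule assms)
  also have "\<dots> = a\<^sup>2 / (\<bar>b\<bar> + 1)\<^sup>2 * (b - 2 * (\<bar>b\<bar> + 1))"
    by (simp add: power2_eq_square divide_simps) (simp add: algebra_simps)
  finally have "0 \<le> a\<^sup>2 / (\<bar>b\<bar> + 1)\<^sup>2 * (b - 2 * (\<bar>b\<bar> + 1))" .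
  moreover have "b - 2 * (\<bar>b\<bar> + 1) < 0" using abs_ge_self[of b] abs_ge_zero[of b] by argo
  ultimately have "a\<^sup>2 / (\<bar>b\<bar> + 1)\<^sup>2 \<le> 0" by (meson mult_pos_neg not_less)
  moreover have "(\<bar>b\<bar> + 1)\<^sup>2 > 0" by (intro zero_less_power) linarith
  ultimately show ?thesis by (simp add: divide_le_0_iff)
qed

text \<open>
  A zero of a nonnegative form is a minimum, so the first variation of the form vanishes there; in the
  direction \<open>A *v x\<close> this variation is twice the squared norm of \<open>A *v x\<close>.
\<close>

lemma symmetric_nonneg_form_kernel:
  fixes A :: "real ^ 'n ^ 'n"
  assumes sym: "transpose A = A"
    and nonneg: "\<And>x. 0 \<le> x \<bullet> (A *v x)"
    and zero: "x \<bullet> (A *v x) = 0"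
  shows "A *v x = 0"
proof -
  let ?y = "A *v x"
  have "0 \<le> 2 * t * (?y \<bullet> ?y) + t\<^sup>2 * (?y \<bullet> (A *v ?y))" for t
    using nonneg[of "x + t *\<^sub>R ?y"] form_add_scaled[OF sym, of x t ?y] zero by simp
  then have "?y \<bullet> ?y = 0" by (rule quadratic_nonneg_imp_linear_zero)
  then show ?thesis by simp
qed

text \<open>
  The form attains its maximum \<open>l\<close> on the compact unit sphere, at \<open>u\<close> say. The form of \<open>l\<close> times the
  identity minus \<open>A\<close> is then nonnegative and vanishes at \<open>u\<close>, so \<open>u\<close> is an eigenvector.
\<close>

lemma symmetric_top_eigenvalue:
  fixes A :: "real ^ 'n ^ 'n"
  assumes sym: "transpose A = A"
  obtains l where "eigenvalue A l" and "\<And>x. x \<bullet> (A *v x) \<le> l * (x \<bullet> x)"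
proof -
  let ?S = "sphere 0 1 :: (real ^ 'n) set"
  have "axis undefined 1 \<in> ?S" by simp
  then have "?S \<noteq> {}" by blast
  moreover have "continuous_on ?S (\<lambda>x. x \<bullet> (A *v x))"
    by (intro continuous_intros linear_continuous_on matrix_vector_mul_bounded_linear)
  ultimately have "\<exists>u\<in>?S. \<forall>x\<in>?S. x \<bullet> (A *v x) \<le> u \<bullet> (A *v u)"
    by (intro continuous_attains_sup compact_sphere)
  then obtain u where u: "u \<in> ?S"
    and max: "\<And>x. x \<in> ?S \<Longrightarrow> x \<bullet> (A *v x) \<le> u \<bullet> (A *v u)"
    by blast
  define l where "l = u \<bullet> (A *v u)"
  have uu: "u \<bullet> u = 1" using u by (simp add: dot_square_norm)
  have bound: "x \<bullet> (A *v x) \<le> l * (x \<bullet> x)" for x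
  proof (cases "x = 0")
    case False
    have "((1 / norm x) *\<^sub>R x) \<bullet> (A *v ((1 / norm x) *\<^sub>R x)) \<le> l"
      unfolding l_def by (rule max) (use False in simp)
    then have "(x \<bullet> (A *v x)) / (norm x)\<^sup>2 \<le> l"
      by (simp add: matrix_vector_mult_scaleR power2_eq_square)
    then show ?thesis using False by (simp add: dot_square_norm divide_simps)
  qed simp
  define B where "B = mat l - A"
  have B: "B *v x = l *\<^sub>R x - A *v x" for x
  proof -
    have "mat l *v x = l *\<^sub>R x"
      by (simp add: vec_eq_iff matrix_vector_mult_def mat_def if_distrib if_distribR cong: if_cong)
    then show ?thesis by (simp add: B_def matrix_vector_mult_diff_rdistrib)
  qed
  have symB: "transpose B = B"
    using sym by (simp add: B_def transpose_def mat_def vec_eq_iff)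
  have "B *v u = 0"
  proof (rule symmetric_nonneg_form_kernel[OF symB])
    show "0 \<le> x \<bullet> (B *v x)" for x
      using bound[of x] by (simp add: B inner_diff_right)
    show "u \<bullet> (B *v u) = 0"
      by (simp add: B inner_diff_right uu l_def)
  qed
  then have "A *v u = l *s u" by (simp add: B scalar_mult_eq_scaleR)
  moreover have "u \<noteq> 0" using uu by auto
  ultimately have "eigenvalue A l" unfolding eigenvalue_def by blast
  then show thesis using bound that by blast
qed

text \<open>
  Eigenvectors of different eigenvalues are orthogonal, and a Euclidean space has only finitely many
  pairwise orthogonal vectors. Finiteness is what makes \<^const>\<open>max_eigenvalue\<close>, a \<^const>\<open>Max\<close>,
  meaningful.
\<close>

lemma symmetric_finite_eigenvalues:
  fixes A :: "real ^ 'n ^ 'n"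
  assumes sym: "transpose A = A"
  shows "finite {l. eigenvalue A l}"
proof -
  let ?E = "{l. eigenvalue A l}"
  define w where "w l = (SOME x. x \<noteq> 0 \<and> A *v x = l *s x)" for l
  have w: "w l \<noteq> 0" "A *v w l = l *\<^sub>R w l" if "l \<in> ?E" for l
    using that someI_ex[of "\<lambda>x. x \<noteq> 0 \<and> A *v x = l *s x"]
    by (auto simp: w_def eigenvalue_def scalar_mult_eq_scaleR)
  have orth: "w k \<bullet> w l = 0" if "k \<in> ?E" "l \<in> ?E" "k \<noteq> l" for k l
  proof -
    have "l * (w k \<bullet> w l) = w k \<bullet> (A *v w l)" by (simp add: w(2)[OF that(2)])
    also have "\<dots> = k * (w k \<bullet> w l)" by (simp add: symmetric_inner[OF sym] w(2)[OF that(1)])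
    finally show ?thesis using that(3) by simp
  qed
  have "inj_on w ?E"
  proof (rule inj_onI)
    fix k l assume kl: "k \<in> ?E" "l \<in> ?E" "w k = w l"
    show "k = l"
    proof (rule ccontr)
      assume "k \<noteq> l"
      then have "w l \<bullet> w l = 0" using orth kl by metis
      then show False using w(1) kl(2) by simp
    qed
  qed
  moreover have "pairwise orthogonal (w ` ?E)"
    by (auto simp: pairwise_def orthogonal_def intro!: orth)
  then have "finite (w ` ?E)" by (rule pairwise_orthogonal_imp_finite)
  ultimately show ?thesis using finite_imageD by blast
qed

lemma max_eigenvalue_symmetric:
  fixes A :: "real ^ 'n ^ 'n"
  assumes "transpose A = A"
  shows eigenvalue_max_eigenvalue: "eigenvalue A (max_eigenvalue A)"
    and form_le_max_eigenvalue: "x \<bullet> (A *v x) \<le> max_eigenvalue A * (x \<bullet> x)"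
proof -
  obtain l where l: "eigenvalue A l" and bound: "\<And>x. x \<bullet> (A *v x) \<le> l * (x \<bullet> x)"
    using symmetric_top_eigenvalue[OF assms] by blast
  have fin: "finite {l. eigenvalue A l}" by (rule symmetric_finite_eigenvalues[OF assms])
  then show "eigenvalue A (max_eigenvalue A)"
    unfolding max_eigenvalue_def using Max_in[OF fin] l by blast
  have "l \<le> max_eigenvalue A" unfolding max_eigenvalue_def using fin l by simp
  then have "l * (x \<bullet> x) \<le> max_eigenvalue A * (x \<bullet> x)" by (intro mult_right_mono) auto
  then show "x \<bullet> (A *v x) \<le> max_eigenvalue A * (x \<bullet> x)" using bound[of x] by linarith
qed

section \<open>Inverse matrices and column spaces\<close>

lemma matrix_inv_mult_vector:
  fixes A :: "real ^ 'n ^ 'n"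
  assumes "invertible A"
  shows "A *v (matrix_inv A *v x) = x" and "matrix_inv A *v (A *v x) = x"
proof -
  have "A ** matrix_inv A = mat 1 \<and> matrix_inv A ** A = mat 1"
    unfolding matrix_inv_def by (rule someI_ex) (use assms in \<open>simp add: invertible_def\<close>)
  then show "A *v (matrix_inv A *v x) = x" and "matrix_inv A *v (A *v x) = x"
    by (simp_all add: matrix_vector_mul_assoc)
qed

lemma transpose_matrix_inv_symmetric:
  fixes A :: "real ^ 'n ^ 'n"
  assumes sym: "transpose A = A" and inv: "invertible A"
  shows "transpose (matrix_inv A) = matrix_inv A"
proof -
  let ?B = "matrix_inv A"
  have B: "(?B *v x) \<bullet> y = x \<bullet> (?B *v y)" for x y
    using symmetric_inner[OF sym, of "?B *v x" "?B *v y"]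
    by (simp add: matrix_inv_mult_vector[OF inv])
  have "transpose ?B *v x = ?B *v x" for x
  proof (rule vector_eq_rdot[THEN iffD1], rule allI)
    fix y
    show "(transpose ?B *v x) \<bullet> y = (?B *v x) \<bullet> y"
      by (metis B dot_lmul_matrix transpose_matrix_vector transpose_transpose)
  qed
  then show ?thesis by (simp add: matrix_eq)
qed

lemma matrix_entry_axis: "(A *v axis j 1) $ i = (A :: real ^ 'n ^ 'm) $ i $ j"
  by (simp add: matrix_vector_mult_basis column_def)

text \<open>
  A minimum principle: at an index where \<open>x\<close> is smallest, replacing every entry of \<open>x\<close> by the smallest
  one can only increase the value of \<open>A *v x\<close>, because the off-diagonal entries are nonpositive. So the
  row sum times the smallest entry is nonnegative.
\<close>

lemma nonneg_solution_if_positive_row_sums: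
  fixes A :: "real ^ 'n ^ 'n"
  assumes off: "\<And>i j. i \<noteq> j \<Longrightarrow> A $ i $ j \<le> 0"
    and rows: "\<And>i. 0 < (\<Sum>j\<in>UNIV. A $ i $ j)"
    and nonneg: "\<And>i. 0 \<le> (A *v x) $ i"
  shows "0 \<le> x $ i"
proof -
  obtain a where a: "\<And>j. x $ a \<le> x $ j"
  proof -
    have "Min (range (($) x)) \<in> range (($) x)" by (intro Min_in) auto
    then obtain a where "x $ a = Min (range (($) x))" by (metis imageE)
    then have "x $ a \<le> x $ j" for j by simp
    then show thesis using that by blast
  qed
  have "0 \<le> (\<Sum>j\<in>UNIV. A $ a $ j * x $ j)"
    using nonneg[of a] by (simp add: matrix_vector_mult_def)
  also have "\<dots> \<le> (\<Sum>j\<in>UNIV. A $ a $ j * x $ a)"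
  proof (rule sum_mono)
    fix j
    show "A $ a $ j * x $ j \<le> A $ a $ j * x $ a"
      by (cases "j = a") (auto intro: mult_left_mono_neg a off)
  qed
  also have "\<dots> = (\<Sum>j\<in>UNIV. A $ a $ j) * x $ a" by (simp add: sum_distrib_right)
  finally have "0 \<le> x $ a" using rows[of a] by (simp add: zero_le_mult_iff)
  then show ?thesis using a[of i] by linarith
qed

text \<open>
  The minimum principle applies to a kernel vector and its negative, and to the columns of the inverse,
  whose images are unit vectors.
\<close>

lemma positive_row_sums:
  fixes A :: "real ^ 'n ^ 'n"
  assumes off: "\<And>i j. i \<noteq> j \<Longrightarrow> A $ i $ j \<le> 0"
    and rows: "\<And>i. 0 < (\<Sum>j\<in>UNIV. A $ i $ j)"
  shows invertible_if_positive_row_sums: "invertible A"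
    and matrix_inv_nonneg_if_positive_row_sums: "0 \<le> matrix_inv A $ i $ j"
proof -
  have "x = 0" if "A *v x = 0" for x
  proof -
    have "0 \<le> x $ i" "0 \<le> (- x) $ i" for i
    proof -
      show "0 \<le> x $ i"
        by (rule nonneg_solution_if_positive_row_sums[OF off rows]) (simp_all add: that)
      have neg: "A *v (- x) = 0" using that matrix_vector_mult_scaleR[of A "-1" x] by simp
      show "0 \<le> (- x) $ i"
        by (rule nonneg_solution_if_positive_row_sums[OF off rows]) (simp_all add: neg)
    qed
    then show ?thesis by (simp add: vec_eq_iff order_antisym)
  qed
  then show inv: "invertible A"
    by (simp add: invertible_left_inverse matrix_left_invertible_ker)
  have "0 \<le> (matrix_inv A *v axis j 1) $ i"
    by (rule nonneg_solution_if_positive_row_sums[OF off rows])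
      (simp_all add: matrix_inv_mult_vector[OF inv] axis_def)
  then show "0 \<le> matrix_inv A $ i $ j" by (simp add: matrix_entry_axis)
qed

text \<open>
  Compare both sides of the eigenvector equation in a coordinate of largest absolute value.
\<close>

lemma eigenvalue_le_row_sum:
  fixes A :: "real ^ 'n ^ 'n"
  assumes nonneg: "\<And>i j. 0 \<le> A $ i $ j"
    and rows: "\<And>i. (\<Sum>j\<in>UNIV. A $ i $ j) = s"
    and eig: "eigenvalue A l"
  shows "l \<le> s"
proof -
  obtain x where "x \<noteq> 0" and x: "A *v x = l *s x" using eig unfolding eigenvalue_def by blast
  obtain a where a: "\<And>j. \<bar>x $ j\<bar> \<le> \<bar>x $ a\<bar>"
  proof -
    have "Max (range (\<lambda>j. \<bar>x $ j\<bar>)) \<in> range (\<lambda>j. \<bar>x $ j\<bar>)" by (intro Max_in) auto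
    then obtain a where "\<bar>x $ a\<bar> = Max (range (\<lambda>j. \<bar>x $ j\<bar>))" by (metis imageE)
    then have "\<bar>x $ j\<bar> \<le> \<bar>x $ a\<bar>" for j by simp
    then show thesis using that by blast
  qed
  obtain j where "x $ j \<noteq> 0" using \<open>x \<noteq> 0\<close> by (auto simp: vec_eq_iff)
  then have pos: "0 < \<bar>x $ a\<bar>" using a[of j] by linarith
  have "l * \<bar>x $ a\<bar> \<le> \<bar>(A *v x) $ a\<bar>" by (simp add: x abs_mult mult_right_mono)
  also have "\<dots> \<le> (\<Sum>j\<in>UNIV. \<bar>A $ a $ j * x $ j\<bar>)"
    by (simp add: matrix_vector_mult_def)
  also have "\<dots> \<le> (\<Sum>j\<in>UNIV. A $ a $ j * \<bar>x $ a\<bar>)"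
    by (intro sum_mono) (simp add: abs_mult nonneg a mult_left_mono)
  also have "\<dots> = s * \<bar>x $ a\<bar>" by (simp add: rows flip: sum_distrib_right)
  finally show ?thesis using pos by simp
qed

lemma in_span_columns_iff:
  fixes A :: "real ^ 'n ^ 'm"
  shows "c \<in> span (columns A) \<longleftrightarrow> (\<exists>x. A *v x = c)"
proof
  have "subspace (range ((*v) A))"
    by (intro linear_subspace_image subspace_UNIV matrix_vector_mul_linear)
  moreover have "columns A \<subseteq> range ((*v) A)"
    by (auto simp: columns_def simp flip: matrix_vector_mult_basis)
  ultimately have "span (columns A) \<subseteq> range ((*v) A)" by (rule span_minimal[rotated])
  then show "\<exists>x. A *v x = c" if "c \<in> span (columns A)" using that by auto
qed (auto intro: matrix_vector_mult_in_columnspace)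

section \<open>Information matrices of block designs\<close>

lemma sum_option: "(\<Sum>i\<in>UNIV. f i) = f None + (\<Sum>i\<in>UNIV. f (Some i))"
  for f :: "'v::finite option \<Rightarrow> 'b::comm_monoid_add"
  by (simp add: UNIV_option_conv sum.reindex)

text \<open>
  The shape that the subtracted terms of both information matrices share.
\<close>

lemma weighted_incidence_entry:
  fixes A :: "real ^ 'd ^ 'n"
  shows "(A ** diag_matrix f ** transpose A) $ i $ j = (\<Sum>k\<in>UNIV. A $ i $ k * f k * A $ j $ k)"
  by (simp add: matrix_matrix_mult_def diag_matrix_def transpose_def if_distrib cong: if_cong)

lemma treatment_info_entry:
  "treatment_info m \<zeta> $ i $ j = (if i = j then real (replication \<zeta> i) else 0)
    - (\<Sum>k\<in>UNIV. real (\<zeta> i k) * real (\<zeta> j k) / real (m k))"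
  unfolding treatment_info_def
  by (simp add: weighted_incidence_entry incidence_def) (simp add: diag_matrix_def)

lemma control_info_entry: "control_info m \<zeta> $ i $ j = treatment_info m \<zeta> $ Some i $ Some j"
  unfolding control_info_def treatment_info_entry
  by (simp add: weighted_incidence_entry test_incidence_def) (simp add: diag_matrix_def)

lemma transpose_treatment_info: "transpose (treatment_info m \<zeta>) = treatment_info m \<zeta>"
  by (simp add: vec_eq_iff transpose_def treatment_info_entry mult.commute)

lemma transpose_control_info: "transpose (control_info m \<zeta>) = control_info m \<zeta>"
  by (simp add: vec_eq_iff transpose_def control_info_entry treatment_info_entry mult.commute)

definition extend_by_zero :: "real ^ 'v::finite \<Rightarrow> real ^ ('v option)" where
  "extend_by_zero z = (\<chi> i. case i of None \<Rightarrow> 0 | Some j \<Rightarrow> z $ j)"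

lemma inner_control_contrasts:
  "x \<bullet> (control_contrasts *v z) = (\<Sum>i\<in>UNIV. (x $ Some i - x $ None) * z $ i)"
proof -
  have "(control_contrasts *v z) $ Some i = z $ i" for i
    by (simp add: matrix_vector_mult_def control_contrasts_def if_distrib if_distribR cong: if_cong)
  moreover have "(control_contrasts *v z) $ None = - (\<Sum>i\<in>UNIV. z $ i)"
    by (simp add: matrix_vector_mult_def control_contrasts_def sum_negf)
  ultimately show ?thesis
    by (simp add: inner_vec_def sum_option algebra_simps sum_subtractf sum_distrib_left)
qed

lemma inner_extend_by_zero_contrasts:
  "extend_by_zero w \<bullet> (control_contrasts *v z) = w \<bullet> z"
  unfolding inner_control_contrasts by (simp add: extend_by_zero_def inner_vec_def)

lemma average_contrast_eq:
  "average_contrast = control_contrasts *v ((\<chi> i. 1 / real CARD('v)) :: real ^ 'v::finite)"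
  by (auto simp: vec_eq_iff average_contrast_def control_contrasts_def matrix_vector_mult_def
      if_distrib if_distribR sum_negf cong: if_cong split: option.split)

lemma feasible_iff_contrasts_in_range:
  "feasible m \<zeta> \<longleftrightarrow> (\<forall>z. \<exists>x. treatment_info m \<zeta> *v x = control_contrasts *v z)"
  unfolding feasible_def by (auto simp: subset_iff in_span_columns_iff)

text \<open>
  If \<open>x\<close> is read as a covariate that depends on the treatment only, these are the values that remain
  after the block means have been removed.
\<close>

definition within_block_deviation ::
  "('d::finite \<Rightarrow> nat) \<Rightarrow> ('v::finite, 'd) design \<Rightarrow> real ^ ('v option) \<Rightarrow> 'v option \<Rightarrow> 'd \<Rightarrow> real"
  where
  "within_block_deviation m \<zeta> x i k = x $ i - (\<Sum>j\<in>UNIV. real (\<zeta> j k) * x $ j) / real (m k)"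

lemma treatment_info_mult:
  "(treatment_info m \<zeta> *v x) $ i
    = (\<Sum>k\<in>UNIV. real (\<zeta> i k) * within_block_deviation m \<zeta> x i k)"
proof -
  have "(treatment_info m \<zeta> *v x) $ i
      = (\<Sum>j\<in>UNIV. (if i = j then real (replication \<zeta> i) * x $ j else 0)
          - (\<Sum>k\<in>UNIV. real (\<zeta> i k) * real (\<zeta> j k) / real (m k)) * x $ j)"
    unfolding matrix_vector_mult_def
    by (auto simp: treatment_info_entry algebra_simps intro!: sum.cong)
  also have "\<dots> = real (replication \<zeta> i) * x $ i
      - (\<Sum>j\<in>UNIV. \<Sum>k\<in>UNIV. real (\<zeta> i k) * real (\<zeta> j k) / real (m k) * x $ j)"
    by (simp add: sum_subtractf sum_distrib_right)
  also have "\<dots> = (\<Sum>k\<in>UNIV. real (\<zeta> i k) * x $ i)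
      - (\<Sum>k\<in>UNIV. \<Sum>j\<in>UNIV. real (\<zeta> i k) * real (\<zeta> j k) / real (m k) * x $ j)"
    by (subst sum.swap) (simp add: replication_def sum_distrib_right)
  also have "\<dots> = (\<Sum>k\<in>UNIV. real (\<zeta> i k) * within_block_deviation m \<zeta> x i k)"
    by (simp add: within_block_deviation_def right_diff_distrib sum_subtractf sum_distrib_left
        sum_divide_distrib mult_ac)
  finally show ?thesis .
qed

context
  fixes m :: "'d::finite \<Rightarrow> nat" and \<zeta> :: "('v::finite, 'd) design"
  assumes block_size_pos: "\<And>k. m k > 0" and design: "\<zeta> \<in> designs m"
begin

lemma block_size: "(\<Sum>i\<in>UNIV. real (\<zeta> i k)) = real (m k)"
  using design by (simp add: designs_def flip: of_nat_sum)

lemma sum_within_block_deviation: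
  "(\<Sum>i\<in>UNIV. real (\<zeta> i k) * within_block_deviation m \<zeta> x i k) = 0"
proof -
  have "(\<Sum>i\<in>UNIV. real (\<zeta> i k) * within_block_deviation m \<zeta> x i k)
      = (\<Sum>i\<in>UNIV. real (\<zeta> i k) * x $ i)
        - (\<Sum>i\<in>UNIV. real (\<zeta> i k)) * ((\<Sum>j\<in>UNIV. real (\<zeta> j k) * x $ j) / real (m k))"
    by (simp add: within_block_deviation_def right_diff_distrib sum_subtractf sum_distrib_right
        flip: sum_divide_distrib)
  then show ?thesis using block_size_pos[of k] by (simp add: block_size)
qed

text \<open>
  The deviations sum to zero over each block, so any block effects \<open>g\<close> may be added to \<open>y\<close>. Choosing
  minus the block means of \<open>y\<close> shows that the form is a sum of squares; choosing the fitted
  block effects makes the fitted mean response appear.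
\<close>

lemma inner_treatment_info:
  "y \<bullet> (treatment_info m \<zeta> *v x)
    = (\<Sum>i\<in>UNIV. \<Sum>k\<in>UNIV. real (\<zeta> i k) * ((y $ i + g k) * within_block_deviation m \<zeta> x i k))"
proof -
  have "(\<Sum>i\<in>UNIV. \<Sum>k\<in>UNIV. real (\<zeta> i k) * (g k * within_block_deviation m \<zeta> x i k))
      = (\<Sum>k\<in>UNIV. g k * (\<Sum>i\<in>UNIV. real (\<zeta> i k) * within_block_deviation m \<zeta> x i k))"
    by (subst sum.swap) (simp add: sum_distrib_left mult_ac)
  also have "\<dots> = 0" by (simp add: sum_within_block_deviation)
  finally show ?thesis
    by (simp add: inner_vec_def treatment_info_mult sum_distrib_left algebra_simps sum.distrib)
qed

lemma treatment_info_nonneg: "0 \<le> x \<bullet> (treatment_info m \<zeta> *v x)"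
proof -
  have "x \<bullet> (treatment_info m \<zeta> *v x)
      = (\<Sum>i\<in>UNIV. \<Sum>k\<in>UNIV. real (\<zeta> i k) * (within_block_deviation m \<zeta> x i k)\<^sup>2)"
    by (simp add: inner_treatment_info[where g = "\<lambda>k. - (\<Sum>j\<in>UNIV. real (\<zeta> j k) * x $ j) / real (m k)"]
        within_block_deviation_def power2_eq_square)
  then show ?thesis by (simp add: sum_nonneg)
qed

lemma sum_treatment_info: "(\<Sum>i\<in>UNIV. (treatment_info m \<zeta> *v x) $ i) = 0"
  using inner_treatment_info[of "vec 1" x "\<lambda>_. - 1"] by (simp add: inner_vec_def)

text \<open>
  This identity carries \<^const>\<open>control_info\<close> over to \<^const>\<open>treatment_info\<close>: the test rows
  agree because \<^const>\<open>control_info\<close> is the corresponding submatrix, and the control row because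
  the entries of both sides sum to zero.
\<close>

lemma treatment_info_extend_by_zero:
  "treatment_info m \<zeta> *v extend_by_zero z = control_contrasts *v (control_info m \<zeta> *v z)"
proof -
  have Some: "(treatment_info m \<zeta> *v extend_by_zero z) $ Some i = (control_info m \<zeta> *v z) $ i" for i
    by (simp add: matrix_vector_mult_def sum_option extend_by_zero_def control_info_entry)
  have "(treatment_info m \<zeta> *v extend_by_zero z) $ None
      = - (\<Sum>i\<in>UNIV. (control_info m \<zeta> *v z) $ i)"
    using sum_treatment_info[of "extend_by_zero z"] by (simp add: sum_option Some)
  moreover have "(control_contrasts *v w) $ None = - (\<Sum>i\<in>UNIV. w $ i)"
    "(control_contrasts *v w) $ Some i = w $ i" for w :: "real ^ 'v" and i
    by (simp_all add: matrix_vector_mult_def control_contrasts_def sum_negf if_distrib if_distribR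
        cong: if_cong)
  ultimately show ?thesis
    unfolding vec_eq_iff by (metis Some option.exhaust)
qed

text \<open>
  If \<open>z\<close> is in the kernel of the control information matrix, then its extension by zero is in the
  kernel of the treatment information matrix, hence orthogonal to its range; if that range contains the
  contrast with coefficients \<open>z\<close>, then \<open>z\<close> is orthogonal to itself.
\<close>

lemma feasible_iff_invertible: "feasible m \<zeta> \<longleftrightarrow> invertible (control_info m \<zeta>)"
proof
  assume feasible: "feasible m \<zeta>"
  have "z = 0" if z: "control_info m \<zeta> *v z = 0" for z
  proof -
    obtain x where x: "treatment_info m \<zeta> *v x = control_contrasts *v z"
      using feasible unfolding feasible_iff_contrasts_in_range by blast
    have "z \<bullet> z = extend_by_zero z \<bullet> (treatment_info m \<zeta> *v x)"
      by (simp add: x inner_extend_by_zero_contrasts)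
    also have "\<dots> = 0"
      by (simp add: symmetric_inner[OF transpose_treatment_info] treatment_info_extend_by_zero z)
    finally show ?thesis by simp
  qed
  then show "invertible (control_info m \<zeta>)"
    by (simp add: invertible_left_inverse matrix_left_invertible_ker)
next
  assume "invertible (control_info m \<zeta>)"
  then show "feasible m \<zeta>"
    unfolding feasible_iff_contrasts_in_range
    by (metis treatment_info_extend_by_zero matrix_inv_mult_vector(1))
qed

lemma treatment_info_solution:
  assumes "feasible m \<zeta>"
  shows "treatment_info m \<zeta> *v extend_by_zero (matrix_inv (control_info m \<zeta>) *v z)
    = control_contrasts *v z"
  using assms by (simp add: feasible_iff_invertible treatment_info_extend_by_zero
      matrix_inv_mult_vector)

text \<open>
  A block of size \<open>s\<close> with \<open>a\<close> control trials contributes \<open>a - a\<^sup>2 / s\<close>, which is largest at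
  \<open>a = s / 2\<close>.
\<close>

lemma treatment_info_control_diagonal_le:
  "axis None 1 \<bullet> (treatment_info m \<zeta> *v axis None 1) \<le> real (num_trials m) / 4"
proof -
  have "axis None 1 \<bullet> (treatment_info m \<zeta> *v axis None 1)
      = (\<Sum>k\<in>UNIV. real (\<zeta> None k) - real (\<zeta> None k) * real (\<zeta> None k) / real (m k))"
    by (simp add: inner_axis' matrix_entry_axis treatment_info_entry replication_def sum_subtractf)
  also have "\<dots> \<le> (\<Sum>k\<in>UNIV. real (m k) / 4)"
  proof (rule sum_mono)
    fix k
    have "0 \<le> (2 * real (\<zeta> None k) - real (m k))\<^sup>2" by simp
    then show "real (\<zeta> None k) - real (\<zeta> None k) * real (\<zeta> None k) / real (m k) \<le> real (m k) / 4"
      using block_size_pos[of k] by (simp add: divide_simps power2_eq_square algebra_simps)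
  qed
  finally show ?thesis by (simp add: num_trials_def sum_divide_distrib)
qed

lemma num_trials_pos: "0 < real (num_trials m)"
  unfolding num_trials_def using block_size_pos by (simp add: sum_pos)

text \<open>
  The left-hand side of the assumption has entry \<open>- 1\<close> at the control, so \<open>x\<close> cannot be small in the
  form of the information matrix, whose control entry is at most a quarter of the number of trials.
\<close>

lemma average_contrast_variance_bound:
  assumes "treatment_info m \<zeta> *v x = average_contrast"
  shows "4 / real (num_trials m) \<le> x \<bullet> average_contrast"
proof -
  define n where "n = real (num_trials m)"
  define e where "e = (axis None 1 :: real ^ ('v option))"
  have n: "n > 0" unfolding n_def by (rule num_trials_pos)
  \<comment> \<open>The multiplier \<open>4 / n\<close> minimizes \<open>x \<bullet> average_contrast - 2 t + t\<^sup>2 (n / 4)\<close> over \<open>t\<close>.\<close>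
  have "0 \<le> x \<bullet> average_contrast + 2 * (4 / n) * (e \<bullet> average_contrast)
      + (4 / n)\<^sup>2 * (e \<bullet> (treatment_info m \<zeta> *v e))"
    using treatment_info_nonneg[of "x + (4 / n) *\<^sub>R e"]
    unfolding form_add_scaled[OF transpose_treatment_info] assms .
  also have "e \<bullet> average_contrast = - 1"
    by (simp add: e_def inner_axis' average_contrast_def)
  also have "(4 / n)\<^sup>2 * (e \<bullet> (treatment_info m \<zeta> *v e)) \<le> (4 / n)\<^sup>2 * (n / 4)"
    unfolding e_def n_def by (intro mult_left_mono treatment_info_control_diagonal_le) simp
  also have "(4 / n)\<^sup>2 * (n / 4) = 4 / n" using n by (simp add: power2_eq_square)
  finally show ?thesis by (simp add: n_def)
qed

text \<open>
  The vector \<open>u\<close> of coefficients \<open>1 / v\<close> turns the variance bound for the average contrast into a bound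
  for the sum of all entries of the inverse.
\<close>

lemma inverse_control_info_sum_bound:
  assumes "feasible m \<zeta>"
  shows "4 * (real CARD('v))\<^sup>2 / real (num_trials m)
    \<le> vec 1 \<bullet> (matrix_inv (control_info m \<zeta>) *v vec 1)"
proof -
  define u :: "real ^ 'v" where "u = (\<chi> i. 1 / real CARD('v))"
  have u: "u = (1 / real CARD('v)) *\<^sub>R vec 1" by (simp add: u_def vec_eq_iff)
  let ?x = "extend_by_zero (matrix_inv (control_info m \<zeta>) *v u)"
  have "treatment_info m \<zeta> *v ?x = average_contrast"
    by (simp add: treatment_info_solution[OF assms] average_contrast_eq u_def)
  then have "4 / real (num_trials m) \<le> ?x \<bullet> average_contrast"
    by (rule average_contrast_variance_bound)
  also have "\<dots> = (matrix_inv (control_info m \<zeta>) *v u) \<bullet> u"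
    by (simp add: average_contrast_eq inner_extend_by_zero_contrasts flip: u_def)
  also have "\<dots> = (vec 1 \<bullet> (matrix_inv (control_info m \<zeta>) *v vec 1)) / (real CARD('v))\<^sup>2"
    by (simp add: u matrix_vector_mult_scaleR power2_eq_square inner_commute)
  finally show ?thesis by (simp add: divide_simps mult_ac)
qed

text \<open>
  The sum of all entries is \<open>v\<close> times the Rayleigh quotient at the all-ones vector.
\<close>

lemma max_eigenvalue_bound:
  assumes "feasible m \<zeta>"
  shows "4 * real CARD('v) / real (num_trials m) \<le> max_eigenvalue (matrix_inv (control_info m \<zeta>))"
proof -
  let ?A = "matrix_inv (control_info m \<zeta>)"
  have "transpose ?A = ?A"
    using assms
    by (simp add: transpose_matrix_inv_symmetric transpose_control_info feasible_iff_invertible)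
  then have "vec 1 \<bullet> (?A *v vec 1) \<le> max_eigenvalue ?A * (vec 1 \<bullet> (vec 1 :: real ^ 'v))"
    by (rule form_le_max_eigenvalue)
  also have "vec 1 \<bullet> (vec 1 :: real ^ 'v) = real CARD('v)" by (simp add: inner_vec_def)
  finally have "4 * (real CARD('v))\<^sup>2 / real (num_trials m) \<le> max_eigenvalue ?A * real CARD('v)"
    using inverse_control_info_sum_bound[OF assms] by linarith
  then have "4 * real CARD('v) / real (num_trials m) * real CARD('v)
      \<le> max_eigenvalue ?A * real CARD('v)"
    by (simp add: power2_eq_square)
  then show ?thesis by (rule mult_right_le_imp_le) simp
qed

end

section \<open>Designs with the control in half of every block\<close>

context
  fixes m :: "'d::finite \<Rightarrow> nat" and \<xi> :: "('v::finite, 'd) design"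
  assumes block_size_pos: "\<And>k. m k > 0" and design: "\<xi> \<in> designs m"
    and half: "\<And>k. real (\<xi> None k) = real (m k) / 2"
    and equireplicated: "\<And>i j. replication \<xi> (Some i) = replication \<xi> (Some j)"
begin

lemma test_replication:
  "real (replication \<xi> (Some i)) = real (num_trials m) / (2 * real CARD('v))"
proof -
  have "(\<Sum>j\<in>UNIV. real (replication \<xi> (Some j)))
      = (\<Sum>k\<in>UNIV. \<Sum>j\<in>UNIV. real (\<xi> (Some j) k))"
    unfolding replication_def of_nat_sum by (rule sum.swap)
  also have "\<dots> = (\<Sum>k\<in>UNIV. real (m k) / 2)"
  proof (rule sum.cong[OF refl])
    fix k
    show "(\<Sum>j\<in>UNIV. real (\<xi> (Some j) k)) = real (m k) / 2"
      using block_size[OF block_size_pos design, of k] by (simp add: sum_option half)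
  qed
  also have "\<dots> = real (num_trials m) / 2" by (simp add: num_trials_def sum_divide_distrib)
  also have "(\<Sum>j\<in>UNIV. real (replication \<xi> (Some j))) = real CARD('v) * real (replication \<xi> (Some i))"
  proof -
    have "(\<Sum>j\<in>UNIV. real (replication \<xi> (Some j))) = (\<Sum>j\<in>(UNIV :: 'v set). real (replication \<xi> (Some i)))"
      by (intro sum.cong refl arg_cong[where f = real] equireplicated)
    then show ?thesis by simp
  qed
  finally show ?thesis by (simp add: field_simps)
qed

text \<open>
  With \<open>\<xi> None k = m k / 2\<close>, the entry at treatment \<open>i\<close> is \<open>- 1 / 2\<close> times the replication of \<open>i\<close>, and
  \<open>n / 2 - n / 4\<close> at the control; equal replications make this column a multiple of the average
  contrast. This is where the two assumptions on the design meet.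
\<close>

lemma treatment_info_control_column:
  "treatment_info m \<xi> *v axis None 1 = (- real (num_trials m) / 4) *\<^sub>R average_contrast"
proof -
  have "(treatment_info m \<xi> *v axis None 1) $ i = (- real (num_trials m) / 4) * average_contrast $ i" for i
  proof -
    have "(\<Sum>k\<in>UNIV. real (\<xi> i k) * real (\<xi> None k) / real (m k)) = real (replication \<xi> i) / 2"
      unfolding replication_def of_nat_sum sum_divide_distrib
      using block_size_pos by (intro sum.cong) (auto simp: half)
    moreover have "real (replication \<xi> None) = real (num_trials m) / 2"
      by (simp add: replication_def num_trials_def half sum_divide_distrib)
    ultimately show ?thesis
      by (cases i) (simp_all add: matrix_entry_axis treatment_info_entry average_contrast_def
          test_replication)
  qed
  then show ?thesis by (simp add: vec_eq_iff)
qed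

lemma average_contrast_solution:
  "treatment_info m \<xi> *v ((- 4 / real (num_trials m)) *\<^sub>R axis None 1) = average_contrast"
  using num_trials_pos[OF block_size_pos design]
  by (simp add: matrix_vector_mult_scaleR treatment_info_control_column del: scaleR_minus_left)

text \<open>
  The rows of \<^const>\<open>treatment_info\<close> sum to zero, so a row sum of \<^const>\<open>control_info\<close> is minus
  an entry of the control column.
\<close>

lemma control_info_row_sum:
  "(\<Sum>j\<in>UNIV. control_info m \<xi> $ i $ j) = real (num_trials m) / (4 * real CARD('v))"
proof -
  have "(treatment_info m \<xi> *v vec 1) $ Some i = 0"
    using block_size_pos
    by (simp add: treatment_info_mult within_block_deviation_def block_size[OF block_size_pos design]
        less_imp_neq[symmetric])
  then have "treatment_info m \<xi> $ Some i $ None + (\<Sum>j\<in>UNIV. control_info m \<xi> $ i $ j) = 0"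
    by (simp add: matrix_vector_mult_def sum_option control_info_entry)
  moreover have "treatment_info m \<xi> $ Some i $ None
      = - real (num_trials m) / 4 * (average_contrast $ Some i)"
    using treatment_info_control_column by (simp flip: matrix_entry_axis)
  ultimately show ?thesis by (simp add: average_contrast_def)
qed

lemma control_info_offdiagonal: "i \<noteq> j \<Longrightarrow> control_info m \<xi> $ i $ j \<le> 0"
  by (simp add: control_info_entry treatment_info_entry sum_nonneg)

lemma control_info_row_sum_pos: "0 < (\<Sum>j\<in>UNIV. control_info m \<xi> $ i $ j)"
  unfolding control_info_row_sum using num_trials_pos[OF block_size_pos design] by simp

lemma half_control_feasible: "feasible m \<xi>"
  unfolding feasible_iff_invertible[OF block_size_pos design]
  by (rule invertible_if_positive_row_sums[OF control_info_offdiagonal control_info_row_sum_pos])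

lemma inverse_control_info_nonneg: "0 \<le> matrix_inv (control_info m \<xi>) $ i $ j"
  by (rule matrix_inv_nonneg_if_positive_row_sums[OF control_info_offdiagonal control_info_row_sum_pos])

lemma inverse_control_info_row_sum:
  "(\<Sum>j\<in>UNIV. matrix_inv (control_info m \<xi>) $ i $ j) = 4 * real CARD('v) / real (num_trials m)"
proof -
  let ?s = "real (num_trials m) / (4 * real CARD('v))"
  have inv: "invertible (control_info m \<xi>)"
    using half_control_feasible feasible_iff_invertible[OF block_size_pos design] by blast
  have "control_info m \<xi> *v vec 1 = ?s *\<^sub>R vec 1"
    by (simp add: vec_eq_iff matrix_vector_mult_def control_info_row_sum)
  then have "vec 1 = ?s *\<^sub>R (matrix_inv (control_info m \<xi>) *v vec 1)"
    by (metis matrix_inv_mult_vector(2)[OF inv] matrix_vector_mult_scaleR)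
  then have "1 = ?s * (matrix_inv (control_info m \<xi>) *v vec 1) $ i"
    by (metis vec_component vector_scaleR_component real_scaleR_def)
  then show ?thesis
    using num_trials_pos[OF block_size_pos design]
    by (simp add: matrix_vector_mult_def field_simps)
qed

lemma half_control_max_eigenvalue:
  "max_eigenvalue (matrix_inv (control_info m \<xi>)) \<le> 4 * real CARD('v) / real (num_trials m)"
proof -
  have "transpose (matrix_inv (control_info m \<xi>)) = matrix_inv (control_info m \<xi>)"
    using half_control_feasible feasible_iff_invertible[OF block_size_pos design]
    by (simp add: transpose_matrix_inv_symmetric transpose_control_info)
  then have "eigenvalue (matrix_inv (control_info m \<xi>))
      (max_eigenvalue (matrix_inv (control_info m \<xi>)))"
    by (rule eigenvalue_max_eigenvalue)
  then show ?thesis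
    by (rule eigenvalue_le_row_sum[OF inverse_control_info_nonneg inverse_control_info_row_sum])
qed

lemma half_control_E_optimal: "E_optimal m \<xi>"
  unfolding E_optimal_def is_arg_min_linorder
  using design half_control_feasible
  by (auto intro: order_trans[OF half_control_max_eigenvalue max_eigenvalue_bound[OF block_size_pos]])

end

section \<open>Least squares estimators\<close>

text \<open>
  The right-hand side \<open>t\<close> of the normal equations lies in the range of the Gram operator \<open>G\<close>: its
  component \<open>w\<close> orthogonal to the range satisfies \<open>w \<bullet> G w = 0\<close>, hence is orthogonal to every regressor and
  so to \<open>t\<close> itself.
\<close>

lemma normal_equations_solvable:
  fixes g :: "'i \<Rightarrow> 'p::euclidean_space"
  assumes "finite S"
  obtains b where "\<And>d. (\<Sum>j\<in>S. (y j - g j \<bullet> b) * (g j \<bullet> d)) = 0"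
proof -
  define G where "G b = (\<Sum>j\<in>S. (g j \<bullet> b) *\<^sub>R g j)" for b
  define t where "t = (\<Sum>j\<in>S. y j *\<^sub>R g j)"
  have "linear G"
    unfolding G_def
    by (rule linearI)
      (simp_all add: inner_add_right scaleR_add_left sum.distrib scaleR_sum_right)
  then have range: "subspace (range G)" by (intro linear_subspace_image subspace_UNIV)
  obtain u w where u: "u \<in> span (range G)"
    and w: "\<And>v. v \<in> span (range G) \<Longrightarrow> orthogonal w v" and t: "t = u + w"
    using orthogonal_subspace_decomp_exists[of "range G" t] by metis
  have "0 = w \<bullet> G w" using w[OF span_base, of "G w"] by (simp add: orthogonal_def)
  also have "\<dots> = (\<Sum>j\<in>S. (g j \<bullet> w)\<^sup>2)"
    by (simp add: G_def inner_sum_right power2_eq_square inner_commute)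
  finally have "\<forall>j\<in>S. (g j \<bullet> w)\<^sup>2 = 0"
    using sum_nonneg_eq_0_iff[OF assms, of "\<lambda>j. (g j \<bullet> w)\<^sup>2"] by simp
  then have gw: "w \<bullet> g j = 0" if "j \<in> S" for j using that by (simp add: inner_commute)
  then have "w \<bullet> t = 0" by (simp add: t_def inner_sum_right)
  moreover have "w \<bullet> u = 0" using w[OF u] by (simp add: orthogonal_def)
  ultimately have "w \<bullet> w = 0" by (simp add: t inner_add_right)
  then have "t \<in> range G" using t u span_eq_iff[THEN iffD2, OF range] by simp
  then obtain b where b: "t = G b" by blast
  have "(\<Sum>j\<in>S. (y j - g j \<bullet> b) * (g j \<bullet> d)) = (t - G b) \<bullet> d" for d
    by (simp add: t_def G_def inner_diff_left inner_sum_left left_diff_distrib sum_subtractf)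
  then have "(\<Sum>j\<in>S. (y j - g j \<bullet> b) * (g j \<bullet> d)) = 0" for d by (simp add: b)
  then show thesis by (rule that)
qed

definition regressor ::
  "(nat \<Rightarrow> 'v::finite option \<times> 'd::finite) \<Rightarrow> nat \<Rightarrow> ('v, 'd) params" where
  "regressor L j = (1, axis (fst (L j)) 1, axis (snd (L j)) 1)"

lemma mean_response_eq_inner: "mean_response L b j = regressor L j \<bullet> b"
  by (cases b) (simp add: regressor_def inner_axis')

text \<open>
  The choice made by \<^const>\<open>arg_min\<close> is known only through minimality. By Pythagoras every minimizer
  has the same fitted values as a solution \<open>b0\<close> of the normal equations, so it solves them as
  well; since \<open>b0\<close> exists, minimizers exist.
\<close>

lemma least_squares_normal_equations:
  fixes L :: "nat \<Rightarrow> 'v::finite option \<times> 'd::finite" and n :: nat and y :: "nat \<Rightarrow> real"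
  defines "b \<equiv> arg_min (residual_ss n L y) (\<lambda>_. True)"
  shows "(\<Sum>j=1..n. (y j - mean_response L b j) * mean_response L d j) = 0"
proof -
  let ?f = "residual_ss n L y" and ?g = "regressor L"
  obtain b0 where b0: "\<And>d. (\<Sum>j=1..n. (y j - ?g j \<bullet> b0) * (?g j \<bullet> d)) = 0"
    using normal_equations_solvable[of "{1..n}" y ?g] by auto
  have pythagoras: "?f b1 = ?f b0 + (\<Sum>j=1..n. (?g j \<bullet> (b1 - b0))\<^sup>2)" for b1
  proof -
    have "?f b1 = (\<Sum>j=1..n. (y j - ?g j \<bullet> b0)\<^sup>2 + (?g j \<bullet> (b1 - b0))\<^sup>2
        - 2 * ((y j - ?g j \<bullet> b0) * (?g j \<bullet> (b1 - b0))))"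
      unfolding residual_ss_def mean_response_eq_inner
      by (intro sum.cong refl) (simp add: inner_diff_right power2_eq_square algebra_simps)
    then show ?thesis
      using b0[of "b1 - b0"]
      by (simp add: sum.distrib sum_subtractf residual_ss_def mean_response_eq_inner
          flip: sum_distrib_left)
  qed
  have "?f b0 \<le> ?f b1" for b1 unfolding pythagoras[of b1] by (simp add: sum_nonneg)
  then have "is_arg_min ?f (\<lambda>_. True) b0" by (simp add: is_arg_min_linorder)
  then have "is_arg_min ?f (\<lambda>_. True) b"
    unfolding b_def arg_min_def by (rule someI)
  then have "?f b \<le> ?f b0" unfolding is_arg_min_linorder by blast
  then have "(\<Sum>j=1..n. (?g j \<bullet> (b - b0))\<^sup>2) \<le> 0" using pythagoras[of b] by linarith
  then have "(\<Sum>j=1..n. (?g j \<bullet> (b - b0))\<^sup>2) = 0" by (intro antisym sum_nonneg) auto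
  then have "\<forall>j\<in>{1..n}. (?g j \<bullet> (b - b0))\<^sup>2 = 0"
    by (subst (asm) sum_nonneg_eq_0_iff) auto
  then have "?g j \<bullet> b = ?g j \<bullet> b0" if "j \<in> {1..n}" for j
    using that by (simp add: inner_diff_right)
  then show ?thesis
    using b0[of d] by (simp add: mean_response_eq_inner)
qed

lemma sum_layout:
  assumes "L \<in> layouts m \<zeta>"
  shows "(\<Sum>j=1..num_trials m. f (fst (L j)) (snd (L j)))
    = (\<Sum>i\<in>UNIV. \<Sum>k\<in>UNIV. real (\<zeta> i k) * f i k)"
proof -
  have "(\<Sum>j=1..num_trials m. f (fst (L j)) (snd (L j)))
      = (\<Sum>p\<in>UNIV. real (card {j \<in> {1..num_trials m}. L j = p}) * f (fst p) (snd p))"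
    using sum_fun_comp[of "{1..num_trials m}" UNIV L "\<lambda>p. f (fst p) (snd p)"] by simp
  also have "\<dots> = (\<Sum>(i, k)\<in>UNIV \<times> UNIV. real (\<zeta> i k) * f i k)"
    using assms by (intro sum.cong) (auto simp: layouts_def)
  finally show ?thesis by (simp add: sum.cartesian_product)
qed

text \<open>
  Evaluating the bilinear form of the information matrix trial by trial, in any layout of the design.
\<close>

lemma sum_layout_deviation:
  assumes "\<And>k. m k > 0" "\<zeta> \<in> designs m" "L \<in> layouts m \<zeta>"
  shows "(\<Sum>j=1..num_trials m. within_block_deviation m \<zeta> x (fst (L j)) (snd (L j))
      * (y $ fst (L j) + g (snd (L j)))) = y \<bullet> (treatment_info m \<zeta> *v x)"
  using sum_layout[OF assms(3), of "\<lambda>i k. within_block_deviation m \<zeta> x i k * (y $ i + g k)"]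
  by (simp add: inner_treatment_info[OF assms(1,2), of y x g] mult_ac)

text \<open>
  The weights are the mean responses of the parameter vector with treatment effects \<open>x\<close> and minus
  the block means of \<open>x\<close> as block effects, so by the normal equations they give the same sum over the
  responses as over the fitted values. Over the fitted values the general mean and the block effects
  cancel, and what is left is \<open>\<tau> \<bullet> (treatment_info m \<zeta> *v x) = \<tau> \<bullet> c\<close>.
\<close>

lemma lse_eq_weighted_sum:
  assumes "\<And>k. m k > 0" "\<zeta> \<in> designs m" "L \<in> layouts m \<zeta>"
    and x: "treatment_info m \<zeta> *v x = c"
  shows "lse (num_trials m) L c y
    = (\<Sum>j=1..num_trials m. within_block_deviation m \<zeta> x (fst (L j)) (snd (L j)) * y j)"
proof -
  let ?w = "\<lambda>j. within_block_deviation m \<zeta> x (fst (L j)) (snd (L j))"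
  obtain \<mu> \<tau> \<theta> where b: "arg_min (residual_ss (num_trials m) L y) (\<lambda>_. True) = (\<mu>, \<tau>, \<theta>)"
    by (metis prod_cases3)
  let ?d = "(0, x, \<chi> k. - (\<Sum>i\<in>UNIV. real (\<zeta> i k) * x $ i) / real (m k))"
  have "(\<Sum>j=1..num_trials m. (y j - mean_response L (\<mu>, \<tau>, \<theta>) j) * mean_response L ?d j) = 0"
    using least_squares_normal_equations[of y L "num_trials m" ?d] unfolding b .
  moreover have "mean_response L ?d j = ?w j" for j by (simp add: within_block_deviation_def)
  ultimately have "(\<Sum>j=1..num_trials m. ?w j * y j)
      = (\<Sum>j=1..num_trials m. ?w j * mean_response L (\<mu>, \<tau>, \<theta>) j)"
    by (simp add: left_diff_distrib sum_subtractf mult.commute del: mean_response.simps)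
  also have "\<dots> = (\<Sum>j=1..num_trials m. ?w j * (\<tau> $ fst (L j) + (\<mu> + \<theta> $ snd (L j))))"
    by (simp add: add_ac)
  also have "\<dots> = \<tau> \<bullet> c"
    unfolding x[symmetric] by (rule sum_layout_deviation[OF assms(1-3)])
  finally show ?thesis by (simp add: lse_def b inner_commute)
qed

lemma square_integrable_imp_integrable_mult:
  fixes X Y :: "'a \<Rightarrow> real"
  assumes "X \<in> borel_measurable P" "Y \<in> borel_measurable P"
    and "integrable P (\<lambda>\<omega>. (X \<omega>)\<^sup>2)" "integrable P (\<lambda>\<omega>. (Y \<omega>)\<^sup>2)"
  shows "integrable P (\<lambda>\<omega>. X \<omega> * Y \<omega>)"
proof (rule Bochner_Integration.integrable_bound)
  show "integrable P (\<lambda>\<omega>. (X \<omega>)\<^sup>2 + (Y \<omega>)\<^sup>2)" using assms by simp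
  show "(\<lambda>\<omega>. X \<omega> * Y \<omega>) \<in> borel_measurable P" using assms by simp
  have "\<bar>a * b\<bar> \<le> a\<^sup>2 + b\<^sup>2" for a b :: real
  proof -
    have "2 * (\<bar>a\<bar> * \<bar>b\<bar>) \<le> a\<^sup>2 + b\<^sup>2" using sum_squares_bound[of "\<bar>a\<bar>" "\<bar>b\<bar>"] by simp
    moreover have "0 \<le> \<bar>a\<bar> * \<bar>b\<bar>" by simp
    ultimately show ?thesis unfolding abs_mult by linarith
  qed
  then show "AE \<omega> in P. norm (X \<omega> * Y \<omega>) \<le> norm ((X \<omega>)\<^sup>2 + (Y \<omega>)\<^sup>2)" by auto
qed

lemma covariance_weighted_sums:
  assumes err: "uncorrelated_errors P n \<sigma> \<epsilon>"
  shows "covariance P (\<lambda>\<omega>. \<Sum>j=1..n. a j * (\<mu> j + \<epsilon> j \<omega>)) (\<lambda>\<omega>. \<Sum>j=1..n. b j * (\<mu> j + \<epsilon> j \<omega>))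
    = \<sigma>\<^sup>2 * (\<Sum>j=1..n. a j * b j)"
proof -
  interpret prob_space P using err unfolding uncorrelated_errors_def by blast
  have meas: "\<epsilon> j \<in> borel_measurable P" and sq: "integrable P (\<lambda>\<omega>. (\<epsilon> j \<omega>)\<^sup>2)"
    and zero: "expectation (\<epsilon> j) = 0" and var: "variance (\<epsilon> j) = \<sigma>\<^sup>2" if "j \<in> {1..n}" for j
    using err that unfolding uncorrelated_errors_def by blast+
  have uncorr: "expectation (\<lambda>\<omega>. \<epsilon> i \<omega> * \<epsilon> j \<omega>) = 0" if "i \<in> {1..n}" "j \<in> {1..n}" "i \<noteq> j" for i j
    using err that unfolding uncorrelated_errors_def by blast
  have int: "integrable P (\<epsilon> j)" if "j \<in> {1..n}" for j
    by (rule square_integrable_imp_integrable[OF meas[OF that] sq[OF that]])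
  have int2: "integrable P (\<lambda>\<omega>. \<epsilon> i \<omega> * \<epsilon> j \<omega>)" if "i \<in> {1..n}" "j \<in> {1..n}" for i j
    using that by (intro square_integrable_imp_integrable_mult meas sq)
  have prod: "expectation (\<lambda>\<omega>. \<epsilon> i \<omega> * \<epsilon> j \<omega>) = (if i = j then \<sigma>\<^sup>2 else 0)"
    if "i \<in> {1..n}" "j \<in> {1..n}" for i j
  proof (cases "i = j")
    case True
    then show ?thesis using var[OF that(1)] zero[OF that(1)] by (simp add: power2_eq_square)
  next
    case False
    then show ?thesis using uncorr that by simp
  qed
  have centred: "(\<Sum>j=1..n. w j * (\<mu> j + \<epsilon> j \<omega>)) - expectation (\<lambda>\<omega>. \<Sum>j=1..n. w j * (\<mu> j + \<epsilon> j \<omega>))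
      = (\<Sum>j=1..n. w j * \<epsilon> j \<omega>)" for w :: "nat \<Rightarrow> real" and \<omega>
  proof -
    have "expectation (\<lambda>\<omega>. \<Sum>j=1..n. w j * (\<mu> j + \<epsilon> j \<omega>))
        = (\<Sum>j=1..n. expectation (\<lambda>\<omega>. w j * (\<mu> j + \<epsilon> j \<omega>)))"
      by (intro Bochner_Integration.integral_sum integrable_mult_right
          Bochner_Integration.integrable_add int) auto
    also have "\<dots> = (\<Sum>j=1..n. w j * \<mu> j)"
    proof (rule sum.cong[OF refl])
      fix j assume j: "j \<in> {1..n}"
      show "expectation (\<lambda>\<omega>. w j * (\<mu> j + \<epsilon> j \<omega>)) = w j * \<mu> j"
        using int[OF j] zero[OF j] prob_space by simp
    qed
    finally show ?thesis by (simp add: distrib_left sum.distrib)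
  qed
  have "covariance P (\<lambda>\<omega>. \<Sum>j=1..n. a j * (\<mu> j + \<epsilon> j \<omega>)) (\<lambda>\<omega>. \<Sum>j=1..n. b j * (\<mu> j + \<epsilon> j \<omega>))
      = expectation (\<lambda>\<omega>. \<Sum>i=1..n. \<Sum>j=1..n. (a i * b j) * (\<epsilon> i \<omega> * \<epsilon> j \<omega>))"
    unfolding covariance_def centred by (simp add: sum_product mult_ac)
  also have "\<dots> = (\<Sum>i=1..n. expectation (\<lambda>\<omega>. \<Sum>j=1..n. (a i * b j) * (\<epsilon> i \<omega> * \<epsilon> j \<omega>)))"
    by (intro Bochner_Integration.integral_sum Bochner_Integration.integrable_sum
        integrable_mult_right int2)
  also have "\<dots> = (\<Sum>i=1..n. \<Sum>j=1..n. expectation (\<lambda>\<omega>. (a i * b j) * (\<epsilon> i \<omega> * \<epsilon> j \<omega>)))"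
    by (intro sum.cong refl Bochner_Integration.integral_sum integrable_mult_right int2)
  also have "\<dots> = (\<Sum>i=1..n. \<Sum>j=1..n. (a i * b j) * expectation (\<lambda>\<omega>. \<epsilon> i \<omega> * \<epsilon> j \<omega>))"
    by simp
  also have "\<dots> = (\<Sum>i=1..n. \<Sum>j=1..n. if i = j then a i * b j * \<sigma>\<^sup>2 else 0)"
    by (intro sum.cong refl) (simp add: prod)
  also have "\<dots> = \<sigma>\<^sup>2 * (\<Sum>j=1..n. a j * b j)" by (simp add: sum_distrib_left mult_ac)
  finally show ?thesis .
qed

text \<open>
  Both estimators are weighted sums of uncorrelated responses, and the inner product of their weights is
  \<open>x \<bullet> (treatment_info m \<zeta> *v x')\<close>.
\<close>

lemma lse_cov_eq:
  assumes pos: "\<And>k. m k > 0" and design: "\<zeta> \<in> designs m" and L: "L \<in> layouts m \<zeta>"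
    and err: "uncorrelated_errors P (num_trials m) \<sigma> \<epsilon>"
    and x: "treatment_info m \<zeta> *v x = c" and x': "treatment_info m \<zeta> *v x' = c'"
  shows "lse_cov P \<epsilon> \<beta> (num_trials m) L c c' = \<sigma>\<^sup>2 * (x \<bullet> c')"
proof -
  let ?w = "\<lambda>x j. within_block_deviation m \<zeta> x (fst (L j)) (snd (L j))"
  have "lse_cov P \<epsilon> \<beta> (num_trials m) L c c' = \<sigma>\<^sup>2 * (\<Sum>j=1..num_trials m. ?w x j * ?w x' j)"
    unfolding lse_cov_def lse_eq_weighted_sum[OF pos design L x]
      lse_eq_weighted_sum[OF pos design L x'] response_def
    by (rule covariance_weighted_sums[OF err])
  also have "(\<Sum>j=1..num_trials m. ?w x j * ?w x' j) = x \<bullet> c'"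
    using sum_layout_deviation[OF pos design L, of x' x
        "\<lambda>k. - (\<Sum>i\<in>UNIV. real (\<zeta> i k) * x $ i) / real (m k)"]
    by (simp add: within_block_deviation_def x' mult.commute)
  finally show ?thesis .
qed

lemma lse_var_eq_lse_cov: "lse_var P \<epsilon> \<beta> n L c = lse_cov P \<epsilon> \<beta> n L c c"
  by (simp add: lse_var_def lse_cov_def covariance_def power2_eq_square)

text \<open>
  Variances are covariances of an estimator with itself and are nonnegative, so the diagonal can be
  written with absolute values as well.
\<close>

lemma abs_cov_sum_eq:
  fixes L :: "nat \<Rightarrow> 'v::finite option \<times> 'd::finite"
  shows "abs_cov_sum P \<epsilon> \<beta> n L = (\<Sum>i\<in>UNIV. \<Sum>j\<in>UNIV.
    \<bar>lse_cov P \<epsilon> \<beta> n L (column i control_contrasts) (column j control_contrasts)\<bar>)"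
proof -
  let ?c = "\<lambda>i j. lse_cov P \<epsilon> \<beta> n L (column i control_contrasts) (column j control_contrasts)"
  have "lse_cov P \<epsilon> \<beta> n L c c \<ge> 0" for c
    unfolding lse_var_eq_lse_cov[symmetric] lse_var_def by simp
  then have diag: "(\<Sum>i\<in>UNIV. lse_var P \<epsilon> \<beta> n L (column i control_contrasts)) = (\<Sum>i\<in>UNIV. \<bar>?c i i\<bar>)"
    by (simp add: lse_var_eq_lse_cov)
  also have "\<dots> = (\<Sum>(i, j)\<in>{(i, j). i = j}. \<bar>?c i j\<bar>)"
    by (rule sum.reindex_bij_witness[of _ fst "\<lambda>i. (i, i)"]) auto
  finally have "abs_cov_sum P \<epsilon> \<beta> n L
      = (\<Sum>(i, j)\<in>{(i, j). i = j} \<union> {(i, j). i \<noteq> j}. \<bar>?c i j\<bar>)"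
    unfolding abs_cov_sum_def by (subst sum.union_disjoint) auto
  also have "{(i :: 'v, j :: 'v). i = j} \<union> {(i, j). i \<noteq> j} = UNIV \<times> UNIV" by auto
  finally show ?thesis unfolding sum.cartesian_product .
qed

lemma lse_cov_contrasts:
  fixes \<zeta> :: "('v::finite, 'd::finite) design"
  assumes pos: "\<And>k. m k > 0" and design: "\<zeta> \<in> designs m" and L: "L \<in> layouts m \<zeta>"
    and err: "uncorrelated_errors P (num_trials m) \<sigma> \<epsilon>"
    and feasible: "feasible m \<zeta>"
  shows "lse_cov P \<epsilon> \<beta> (num_trials m) L (column i control_contrasts) (column j control_contrasts)
    = \<sigma>\<^sup>2 * matrix_inv (control_info m \<zeta>) $ j $ i"
proof -
  let ?A = "matrix_inv (control_info m \<zeta>)"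
  have column: "column i control_contrasts = control_contrasts *v axis i (1 :: real)" for i :: 'v
    by (simp add: matrix_vector_mult_basis)
  show ?thesis
    unfolding column
      lse_cov_eq[OF pos design L err treatment_info_solution[OF pos design feasible]
        treatment_info_solution[OF pos design feasible]]
    by (simp add: inner_extend_by_zero_contrasts inner_axis matrix_entry_axis)
qed

lemma abs_cov_sum_bound:
  fixes \<zeta> :: "('v::finite, 'd::finite) design"
  assumes pos: "\<And>k. m k > 0" and design: "\<zeta> \<in> designs m" and L: "L \<in> layouts m \<zeta>"
    and err: "uncorrelated_errors P (num_trials m) \<sigma> \<epsilon>"
    and feasible: "feasible m \<zeta>"
  shows "\<sigma>\<^sup>2 * (4 * (real CARD('v))\<^sup>2 / real (num_trials m)) \<le> abs_cov_sum P \<epsilon> \<beta> (num_trials m) L"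
proof -
  let ?A = "matrix_inv (control_info m \<zeta>)"
  have "\<sigma>\<^sup>2 * (4 * (real CARD('v))\<^sup>2 / real (num_trials m)) \<le> \<sigma>\<^sup>2 * (vec 1 \<bullet> (?A *v vec 1))"
    by (intro mult_left_mono inverse_control_info_sum_bound[OF pos design feasible]) simp
  also have "\<dots> = (\<Sum>j\<in>UNIV. \<Sum>i\<in>UNIV. \<sigma>\<^sup>2 * ?A $ j $ i)"
    by (simp add: inner_vec_def matrix_vector_mult_def sum_distrib_left)
  also have "\<dots> = (\<Sum>i\<in>UNIV. \<Sum>j\<in>UNIV. \<sigma>\<^sup>2 * ?A $ j $ i)"
    by (rule sum.swap)
  also have "\<dots> \<le> abs_cov_sum P \<epsilon> \<beta> (num_trials m) L"
    unfolding abs_cov_sum_eq lse_cov_contrasts[OF assms] by (intro sum_mono abs_ge_self)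
  finally show ?thesis .
qed

text \<open>
  The inverse has nonnegative entries, so taking absolute values changes no covariance.
\<close>

lemma half_control_abs_cov_sum:
  fixes \<xi> :: "('v::finite, 'd::finite) design"
  assumes pos: "\<And>k. m k > 0" and design: "\<xi> \<in> designs m"
    and half: "\<And>k. real (\<xi> None k) = real (m k) / 2"
    and equi: "\<And>i j. replication \<xi> (Some i) = replication \<xi> (Some j)"
    and L: "L \<in> layouts m \<xi>" and err: "uncorrelated_errors P (num_trials m) \<sigma> \<epsilon>"
  shows "abs_cov_sum P \<epsilon> \<beta> (num_trials m) L = \<sigma>\<^sup>2 * (4 * (real CARD('v))\<^sup>2 / real (num_trials m))"
proof -
  let ?A = "matrix_inv (control_info m \<xi>)"
  note half_design = pos design half equi
  have "abs_cov_sum P \<epsilon> \<beta> (num_trials m) L = (\<Sum>i\<in>UNIV. \<Sum>j\<in>UNIV. \<sigma>\<^sup>2 * ?A $ j $ i)"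
    unfolding abs_cov_sum_eq
      lse_cov_contrasts[OF pos design L err half_control_feasible[OF half_design]]
    using inverse_control_info_nonneg[OF half_design] by (simp add: abs_mult)
  also have "\<dots> = \<sigma>\<^sup>2 * (\<Sum>j\<in>UNIV. \<Sum>i\<in>UNIV. ?A $ j $ i)"
    by (subst sum.swap) (simp add: sum_distrib_left)
  also have "\<dots> = \<sigma>\<^sup>2 * (4 * (real CARD('v))\<^sup>2 / real (num_trials m))"
    by (simp add: inverse_control_info_row_sum[OF half_design] power2_eq_square)
  finally show ?thesis .
qed

theorem theorem3:
  fixes m :: "'d::finite \<Rightarrow> nat" and \<xi> :: "('v::finite, 'd) design"
  assumes "\<And>k. m k > 0"
    and "\<xi> \<in> designs m"
    and "\<And>k. real (\<xi> None k) = real (m k) / 2"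
    and "\<And>i j. replication \<xi> (Some i) = replication \<xi> (Some j)"
  shows "E_optimal m \<xi>
    \<and> (\<forall>(P :: 'a measure) \<sigma> \<epsilon> \<beta>. uncorrelated_errors P (num_trials m) \<sigma> \<epsilon> \<longrightarrow>
         minimizes m (estimable m average_contrast)
           (\<lambda>L. lse_var P \<epsilon> \<beta> (num_trials m) L average_contrast) \<xi>
         \<and> minimizes m (feasible m) (abs_cov_sum P \<epsilon> \<beta> (num_trials m)) \<xi>)"
proof (intro conjI allI impI)
  show "E_optimal m \<xi>" by (rule half_control_E_optimal[OF assms])
next
  fix P :: "'a measure" and \<sigma> \<epsilon> and \<beta> :: "('v, 'd) params"
  assume err: "uncorrelated_errors P (num_trials m) \<sigma> \<epsilon>"
  let ?n = "num_trials m"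
  let ?x = "(- 4 / real ?n) *\<^sub>R axis None 1 :: real ^ ('v option)"
  have x: "treatment_info m \<xi> *v ?x = average_contrast"
    by (rule average_contrast_solution[OF assms])
  show "minimizes m (estimable m average_contrast)
      (\<lambda>L. lse_var P \<epsilon> \<beta> ?n L average_contrast) \<xi>"
    unfolding minimizes_def
  proof (intro conjI ballI impI)
    show "estimable m average_contrast \<xi>"
      unfolding estimable_def in_span_columns_iff using x by blast
  next
    fix L K and \<zeta> :: "('v, 'd) design"
    assume L: "L \<in> layouts m \<xi>" and design: "\<zeta> \<in> designs m"
      and estimable: "estimable m average_contrast \<zeta>" and K: "K \<in> layouts m \<zeta>"
    obtain y where y: "treatment_info m \<zeta> *v y = average_contrast"
      using estimable unfolding estimable_def in_span_columns_iff by blast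
    have "lse_var P \<epsilon> \<beta> ?n L average_contrast = \<sigma>\<^sup>2 * (?x \<bullet> average_contrast)"
      unfolding lse_var_eq_lse_cov by (rule lse_cov_eq[OF assms(1,2) L err x x])
    also have "?x \<bullet> average_contrast = 4 / real ?n"
      by (simp add: inner_axis' average_contrast_def)
    also have "\<sigma>\<^sup>2 * (4 / real ?n) \<le> \<sigma>\<^sup>2 * (y \<bullet> average_contrast)"
      by (intro mult_left_mono average_contrast_variance_bound[OF assms(1) design y]) simp
    also have "\<dots> = lse_var P \<epsilon> \<beta> ?n K average_contrast"
      unfolding lse_var_eq_lse_cov by (rule lse_cov_eq[OF assms(1) design K err y y, symmetric])
    finally show "lse_var P \<epsilon> \<beta> ?n L average_contrast \<le> lse_var P \<epsilon> \<beta> ?n K average_contrast" .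
  qed (rule assms(2))
  show "minimizes m (feasible m) (abs_cov_sum P \<epsilon> \<beta> ?n) \<xi>"
    unfolding minimizes_def
  proof (intro conjI ballI impI)
    fix L K and \<zeta> :: "('v, 'd) design"
    assume L: "L \<in> layouts m \<xi>" and design: "\<zeta> \<in> designs m"
      and feasible: "feasible m \<zeta>" and K: "K \<in> layouts m \<zeta>"
    show "abs_cov_sum P \<epsilon> \<beta> ?n L \<le> abs_cov_sum P \<epsilon> \<beta> ?n K"
      unfolding half_control_abs_cov_sum[OF assms L err]
      by (rule abs_cov_sum_bound[OF assms(1) design K err feasible])
  qed (rule assms(2) half_control_feasible[OF assms])+
qed

end
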